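(* Let $X$ be a Urysohn space. Then $|X|\le wL(X)^{\chi(X)\cdot\overline{\Delta}(X)}$.
   Context: A topological space $X$ is Urysohn if every two distinct points of $X$ have disjoint closed neighborhoods. Write $\Delta_X=\{(x,x)\in X^2:x\in X\}$. For an infinite cardinal $\kappa$, $X$ has a regular $G_\kappa$-diagonal if there is a family $(U_\eta:\eta<\kappa)$ of open sets in $X^2$ such that $\Delta_X=\bigcap_{\eta<\kappa}U_\eta=\bigcap_{\eta<\kappa}\overline{U_\eta}$. For a Urysohn space $X$, the regular diagonal degree $\overline{\Delta}(X)$ is the minimal infinite cardinal $\kappa$ such that $X$ has a regular $G_\kappa$-diagonal. The weak Lindelöf number $wL(X)$ is the smallest infinite cardinal $\kappa$ such that every open cover of $X$ has a subcollection of cardinality $\le\kappa$ whose union is dense in $X$. The character $\chi(X)$ is the smallest infinite cardinal $\kappa$ such that every point of $X$ has a local base of cardinality $\le\kappa$. *)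

theory Defs
  imports "HOL-Analysis.Analysis"
begin

unbundle cardinal_syntax
no_notation Set_Algebras.elt_set_eq (infix \<open>=o\<close> 50)

text \<open>Cardinals are represented, as in \<^theory>\<open>HOL.BNF_Cardinal_Arithmetic\<close>, by
  cardinal well-orders \<open>\<kappa> :: 'k rel\<close>, compared across types by \<open>\<le>o\<close> and identified up to \<open>=o\<close>.\<close>

definition is_least_infinite_cardinal :: "('k rel \<Rightarrow> bool) \<Rightarrow> 'k rel \<Rightarrow> bool" where
  "is_least_infinite_cardinal P \<kappa> \<longleftrightarrow>
     Cinfinite \<kappa> \<and> P \<kappa> \<and> (\<forall>\<kappa>'. Cinfinite \<kappa>' \<and> P \<kappa>' \<longrightarrow> \<kappa> \<le>o \<kappa>')"

definition least_infinite_cardinal :: "('k rel \<Rightarrow> bool) \<Rightarrow> 'k rel" where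
  "least_infinite_cardinal P = (SOME \<kappa>. is_least_infinite_cardinal P \<kappa>)"

text \<open>The values of the cardinal functions below are realised on the type \<open>'a set + nat\<close>.
  It is infinite and has room for as many elements as there are open sets, so the
  minimum is attained there; the lemmas after the definitions show that it is also the minimum
  over the cardinals of every other type (for the regular diagonal degree, when \<open>X\<close> is Urysohn).\<close>

type_synonym 'a top_cardinal = "('a set + nat) rel"

definition urysohn_space :: "'a topology \<Rightarrow> bool" where
  "urysohn_space X \<longleftrightarrow>
     (\<forall>x \<in> topspace X. \<forall>y \<in> topspace X. x \<noteq> y \<longrightarrow>
        (\<exists>C D. closedin X C \<and> closedin X D \<and>
               x \<in> X interior_of C \<and> y \<in> X interior_of D \<and> C \<inter> D = {}))"

definition diagonal :: "'a topology \<Rightarrow> ('a \<times> 'a) set" where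
  "diagonal X = {(x, x) | x. x \<in> topspace X}"

definition has_regular_G_diagonal :: "'a topology \<Rightarrow> 'k rel \<Rightarrow> bool" where
  "has_regular_G_diagonal X \<kappa> \<longleftrightarrow>
     (\<exists>U :: 'k \<Rightarrow> ('a \<times> 'a) set.
        (\<forall>\<eta> \<in> Field \<kappa>. openin (prod_topology X X) (U \<eta>)) \<and>
        diagonal X = (\<Inter>\<eta> \<in> Field \<kappa>. U \<eta>) \<and>
        diagonal X = (\<Inter>\<eta> \<in> Field \<kappa>. prod_topology X X closure_of U \<eta>))"

definition regular_diagonal_degree :: "'a topology \<Rightarrow> 'a top_cardinal" where
  "regular_diagonal_degree X = least_infinite_cardinal (has_regular_G_diagonal X)"

definition weakly_Lindelof_upto :: "'a topology \<Rightarrow> 'k rel \<Rightarrow> bool" where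
  "weakly_Lindelof_upto X \<kappa> \<longleftrightarrow>
     (\<forall>\<U>. (\<forall>U \<in> \<U>. openin X U) \<and> \<Union>\<U> = topspace X \<longrightarrow>
        (\<exists>\<V> \<subseteq> \<U>. |\<V>| \<le>o \<kappa> \<and> X closure_of \<Union>\<V> = topspace X))"

definition weak_Lindelof_number :: "'a topology \<Rightarrow> 'a top_cardinal" where
  "weak_Lindelof_number X = least_infinite_cardinal (weakly_Lindelof_upto X)"

definition local_base_at :: "'a topology \<Rightarrow> 'a \<Rightarrow> 'a set set \<Rightarrow> bool" where
  "local_base_at X x \<B> \<longleftrightarrow>
     (\<forall>B \<in> \<B>. openin X B \<and> x \<in> B) \<and>
     (\<forall>U. openin X U \<and> x \<in> U \<longrightarrow> (\<exists>B \<in> \<B>. B \<subseteq> U))"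

definition has_local_bases_upto :: "'a topology \<Rightarrow> 'k rel \<Rightarrow> bool" where
  "has_local_bases_upto X \<kappa> \<longleftrightarrow>
     (\<forall>x \<in> topspace X. \<exists>\<B>. local_base_at X x \<B> \<and> |\<B>| \<le>o \<kappa>)"

definition character :: "'a topology \<Rightarrow> 'a top_cardinal" where
  "character X = least_infinite_cardinal (has_local_bases_upto X)"

lemma is_least_infinite_cardinal_least:
  assumes "Cinfinite \<kappa>" "P \<kappa>"
  shows "is_least_infinite_cardinal P (least_infinite_cardinal P)"
proof -
  let ?Q = "{\<mu>. Cinfinite \<mu> \<and> P \<mu>}"
  from assms have "\<kappa> \<in> ?Q" by simp
  then obtain \<mu> where m: "\<mu> \<in> ?Q" "\<And>\<nu>. \<nu> <o \<mu> \<Longrightarrow> \<nu> \<notin> ?Q"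
    by (rule wfE_min[OF wf_ordLess, of \<kappa> ?Q]) blast
  have "\<mu> \<le>o \<nu>" if "Cinfinite \<nu>" "P \<nu>" for \<nu>
  proof -
    have "\<not> \<nu> <o \<mu>" using m(2) that by blast
    moreover have "Well_order \<mu>" "Well_order \<nu>"
      using m(1) that by (auto simp: card_order_on_well_order_on)
    ultimately show ?thesis using ordLess_or_ordLeq by blast
  qed
  with m(1) have "is_least_infinite_cardinal P \<mu>"
    by (auto simp: is_least_infinite_cardinal_def)
  then show ?thesis unfolding least_infinite_cardinal_def by (rule someI)
qed

lemma least_infinite_cardinal_le:
  fixes \<kappa> :: "'k rel" and P :: "'m rel \<Rightarrow> bool"
  assumes least: "is_least_infinite_cardinal P (least_infinite_cardinal P)"
    and \<kappa>: "Cinfinite \<kappa>" and P: "\<And>\<mu>. \<kappa> =o \<mu> \<Longrightarrow> P \<mu>"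
  shows "least_infinite_cardinal P \<le>o \<kappa>"
proof -
  let ?l = "least_infinite_cardinal P"
  have l: "Card_order ?l" using least by (simp add: is_least_infinite_cardinal_def)
  have wo: "Well_order ?l" "Well_order \<kappa>"
    using l \<kappa> by (auto simp: card_order_on_well_order_on)
  show ?thesis
  proof (rule ccontr)
    assume "\<not> ?l \<le>o \<kappa>"
    then have "\<kappa> \<le>o ?l" using wo ordLeq_total by blast
    then obtain \<mu> :: "'m rel" where \<mu>: "\<kappa> =o \<mu>"
      using internalize_ordLeq[of \<kappa> ?l] by auto
    have "Cinfinite \<mu>" by (rule Cinfinite_cong[OF \<mu> \<kappa>])
    then have "?l \<le>o \<mu>" using least P[OF \<mu>] by (simp add: is_least_infinite_cardinal_def)
    from ordLeq_ordIso_trans[OF this ordIso_symmetric[OF \<mu>]] \<open>\<not> ?l \<le>o \<kappa>\<close>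
    show False by simp
  qed
qed

lemma Cinfinite_UNIV_top_cardinal: "Cinfinite |UNIV :: ('a set + nat) set|"
proof -
  have "infinite (UNIV :: ('a set + nat) set)"
    by (simp flip: UNIV_Plus_UNIV)
  then show ?thesis by (intro conjI card_of_Card_order) (simp add: cinfinite_def Field_card_of)
qed

lemma set_set_le_UNIV_top_cardinal:
  fixes A :: "'a set set" shows "|A| \<le>o |UNIV :: ('a set + nat) set|"
  by (rule card_of_ordLeqI[of Inl]) auto

lemma is_least_weak_Lindelof_number:
  fixes X :: "'a topology"
  shows "is_least_infinite_cardinal (weakly_Lindelof_upto X) (weak_Lindelof_number X)"
proof -
  have "weakly_Lindelof_upto X |UNIV :: ('a set + nat) set|"
    unfolding weakly_Lindelof_upto_def
  proof (intro allI impI)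
    fix \<U> assume "(\<forall>U \<in> \<U>. openin X U) \<and> \<Union>\<U> = topspace X"
    then have "X closure_of \<Union>\<U> = topspace X" by simp
    then show "\<exists>\<V> \<subseteq> \<U>. |\<V>| \<le>o |UNIV :: ('a set + nat) set| \<and>
        X closure_of \<Union>\<V> = topspace X"
      using set_set_le_UNIV_top_cardinal[of \<U>] by (intro exI[of _ \<U>] conjI) auto
  qed
  from Cinfinite_UNIV_top_cardinal this show ?thesis
    unfolding weak_Lindelof_number_def
    by (rule is_least_infinite_cardinal_least)
qed

lemma weak_Lindelof_number_le:
  fixes X :: "'a topology"
  assumes "Cinfinite \<kappa>" "weakly_Lindelof_upto X \<kappa>"
  shows "weak_Lindelof_number X \<le>o \<kappa>"
  unfolding weak_Lindelof_number_def
proof (rule least_infinite_cardinal_le[OF _ assms(1)])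
  show "is_least_infinite_cardinal (weakly_Lindelof_upto X)
      (least_infinite_cardinal (weakly_Lindelof_upto X) :: 'a top_cardinal)"
    using is_least_weak_Lindelof_number[of X] by (simp add: weak_Lindelof_number_def)
next
  fix \<mu> :: "'a top_cardinal" assume "\<kappa> =o \<mu>"
  then show "weakly_Lindelof_upto X \<mu>"
    using assms(2) unfolding weakly_Lindelof_upto_def by (meson ordLeq_ordIso_trans)
qed

lemma is_least_character:
  fixes X :: "'a topology"
  shows "is_least_infinite_cardinal (has_local_bases_upto X) (character X)"
proof -
  have "local_base_at X x {U. openin X U \<and> x \<in> U}" for x
    by (auto simp: local_base_at_def)
  then have "has_local_bases_upto X |UNIV :: ('a set + nat) set|"
    unfolding has_local_bases_upto_def
    using set_set_le_UNIV_top_cardinal by (intro ballI exI conjI)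
  from Cinfinite_UNIV_top_cardinal this show ?thesis
    unfolding character_def
    by (rule is_least_infinite_cardinal_least)
qed

lemma character_le:
  fixes X :: "'a topology"
  assumes "Cinfinite \<kappa>" "has_local_bases_upto X \<kappa>"
  shows "character X \<le>o \<kappa>"
  unfolding character_def
proof (rule least_infinite_cardinal_le[OF _ assms(1)])
  show "is_least_infinite_cardinal (has_local_bases_upto X)
      (least_infinite_cardinal (has_local_bases_upto X) :: 'a top_cardinal)"
    using is_least_character[of X] by (simp add: character_def)
next
  fix \<mu> :: "'a top_cardinal" assume "\<kappa> =o \<mu>"
  then show "has_local_bases_upto X \<mu>"
    using assms(2) unfolding has_local_bases_upto_def by (meson ordLeq_ordIso_trans)
qed

lemma pairs_le_UNIV_top_cardinal:
  "|UNIV :: ('a \<times> 'a) set| \<le>o |UNIV :: ('a set + nat) set|"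
proof (cases "finite (UNIV :: 'a set)")
  case True
  then have "finite (UNIV :: ('a \<times> 'a) set)" by (simp add: finite_prod)
  then show ?thesis
    using Cinfinite_UNIV_top_cardinal[where 'a='a]
    by (intro ordLess_imp_ordLeq finite_ordLess_infinite card_of_Well_order)
       (auto simp: cinfinite_def Field_card_of)
next
  case False
  then have "|UNIV :: ('a \<times> 'a) set| =o |UNIV :: 'a set|"
    using card_of_Times_same_infinite by (metis UNIV_Times_UNIV)
  moreover have "|UNIV :: 'a set| \<le>o |UNIV :: ('a set + nat) set|"
    by (rule card_of_ordLeqI[of "\<lambda>x. Inl {x}"]) (auto intro: injI)
  ultimately show ?thesis using ordIso_ordLeq_trans by blast
qed

lemma has_regular_G_diagonal_UNIV:
  fixes X :: "'a topology"
  assumes "urysohn_space X"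
  shows "has_regular_G_diagonal X |UNIV :: ('a set + nat) set|"
proof -
  let ?Y = "prod_topology X X"
  have "\<exists>W. openin ?Y W \<and> diagonal X \<subseteq> W \<and>
          (p \<in> topspace ?Y - diagonal X \<longrightarrow> p \<notin> ?Y closure_of W)" (is "\<exists>W. ?R p W") for p
  proof (cases "p \<in> topspace ?Y - diagonal X")
    case True
    then obtain x y where p: "p = (x, y)" "x \<in> topspace X" "y \<in> topspace X" "x \<noteq> y"
      by (auto simp: diagonal_def)
    then obtain C D where CD: "closedin X C" "closedin X D"
      "x \<in> X interior_of C" "y \<in> X interior_of D" "C \<inter> D = {}"
      using assms unfolding urysohn_space_def by meson
    let ?W = "topspace ?Y - C \<times> D"
    have cl: "closedin ?Y (C \<times> D)" using CD by (simp add: closedin_prod_Times_iff)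
    have op: "openin ?Y ((X interior_of C) \<times> (X interior_of D))"
      by (simp add: openin_prod_Times_iff)
    have "((X interior_of C) \<times> (X interior_of D)) \<inter> ?W = {}"
      using interior_of_subset[of X C] interior_of_subset[of X D] by blast
    then have "((X interior_of C) \<times> (X interior_of D)) \<inter> ?Y closure_of ?W = {}"
      using openin_Int_closure_of_eq_empty[OF op] by blast
    then have "p \<notin> ?Y closure_of ?W" using p CD by blast
    moreover have "openin ?Y ?W" using cl by (rule openin_diff[OF openin_topspace])
    moreover have "diagonal X \<subseteq> ?W" using CD by (auto simp: diagonal_def)
    ultimately show ?thesis by (intro exI[of _ ?W]) blast
  next
    case False
    then show ?thesis
      by (intro exI[of _ "topspace ?Y"] conjI openin_topspace) (auto simp: diagonal_def)
  qed
  then have "\<exists>W. \<forall>p. ?R p (W p)" by (intro choice allI)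
  then obtain W where "\<forall>p. ?R p (W p)" ..
  then have "?R p (W p)" for p by (rule spec)
  then have W: "\<And>p. openin ?Y (W p)" "\<And>p. diagonal X \<subseteq> W p"
    "\<And>p. p \<in> topspace ?Y - diagonal X \<Longrightarrow> p \<notin> ?Y closure_of W p"
    by blast+
  obtain g :: "'a set + nat \<Rightarrow> 'a \<times> 'a" where g: "range g = UNIV"
    using iffD2[OF card_of_ordLeq2[OF UNIV_not_empty] pairs_le_UNIV_top_cardinal] by blast
  have sub: "W p \<subseteq> ?Y closure_of W p" for p
    by (intro closure_of_subset openin_subset W(1))
  have a: "(\<Inter>\<eta>. ?Y closure_of W (g \<eta>)) \<subseteq> diagonal X" (is "?I2 \<subseteq> _")
  proof
    fix p assume p: "p \<in> (\<Inter>\<eta>. ?Y closure_of W (g \<eta>))"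
    obtain \<eta> where "g \<eta> = p" using g by (metis UNIV_I imageE)
    then have "p \<in> ?Y closure_of W p" using p by blast
    then show "p \<in> diagonal X"
      using W(3)[of p] closure_of_subset_topspace[of ?Y "W p"] by blast
  qed
  have b: "diagonal X \<subseteq> (\<Inter>\<eta>. W (g \<eta>))" (is "_ \<subseteq> ?I1") using W(2) by blast
  have c: "?I1 \<subseteq> ?I2" using sub by (intro INT_anti_mono subset_refl)
  have I1: "diagonal X = ?I1" by (rule subset_antisym[OF b subset_trans[OF c a]])
  have I2: "diagonal X = ?I2" by (rule subset_antisym[OF subset_trans[OF b c] a])
  show ?thesis
    unfolding has_regular_G_diagonal_def Field_card_of
    by (rule exI[of _ "\<lambda>\<eta>. W (g \<eta>)"]) (rule conjI[OF ballI[OF W(1)] conjI[OF I1 I2]])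
qed

lemma is_least_regular_diagonal_degree:
  fixes X :: "'a topology"
  assumes "urysohn_space X"
  shows "is_least_infinite_cardinal (has_regular_G_diagonal X) (regular_diagonal_degree X)"
  unfolding regular_diagonal_degree_def
  by (rule is_least_infinite_cardinal_least, rule Cinfinite_UNIV_top_cardinal,
      rule has_regular_G_diagonal_UNIV[OF assms])

lemma has_regular_G_diagonal_ordIso:
  assumes "has_regular_G_diagonal X \<kappa>" "\<kappa> =o \<mu>"
  shows "has_regular_G_diagonal X \<mu>"
proof -
  obtain f where "iso \<kappa> \<mu> f" using assms(2) by (auto simp: ordIso_def)
  then have f: "bij_betw f (Field \<kappa>) (Field \<mu>)" by (simp add: iso_def)
  let ?g = "inv_into (Field \<kappa>) f"
  have g: "?g ` Field \<mu> = Field \<kappa>"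
    using bij_betw_inv_into[OF f] by (simp add: bij_betw_def)
  obtain U where U: "\<forall>\<eta> \<in> Field \<kappa>. openin (prod_topology X X) (U \<eta>)"
    "diagonal X = \<Inter> (U ` Field \<kappa>)"
    "diagonal X = \<Inter> ((\<lambda>\<eta>. prod_topology X X closure_of U \<eta>) ` Field \<kappa>)"
    using assms(1) unfolding has_regular_G_diagonal_def by blast
  show ?thesis
    unfolding has_regular_G_diagonal_def
  proof (intro exI[of _ "\<lambda>\<eta>. U (?g \<eta>)"] conjI)
    show "\<forall>\<eta> \<in> Field \<mu>. openin (prod_topology X X) (U (?g \<eta>))" using U(1) g by blast
    show "diagonal X = (\<Inter>\<eta> \<in> Field \<mu>. U (?g \<eta>))"
      using U(2) image_image[of U ?g "Field \<mu>"] unfolding g by simp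
    show "diagonal X = (\<Inter>\<eta> \<in> Field \<mu>. prod_topology X X closure_of U (?g \<eta>))"
      using U(3) image_image[of "\<lambda>\<eta>. prod_topology X X closure_of U \<eta>" ?g "Field \<mu>"]
      unfolding g by simp
  qed
qed

lemma regular_diagonal_degree_le:
  fixes X :: "'a topology"
  assumes "urysohn_space X" "Cinfinite \<kappa>" "has_regular_G_diagonal X \<kappa>"
  shows "regular_diagonal_degree X \<le>o \<kappa>"
  unfolding regular_diagonal_degree_def
proof (rule least_infinite_cardinal_le[OF _ assms(2)])
  show "is_least_infinite_cardinal (has_regular_G_diagonal X)
      (least_infinite_cardinal (has_regular_G_diagonal X) :: 'a top_cardinal)"
    using is_least_regular_diagonal_degree[OF assms(1)]
    by (simp add: regular_diagonal_degree_def)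
next
  fix \<mu> :: "'a top_cardinal" assume "\<kappa> =o \<mu>"
  then show "has_regular_G_diagonal X \<mu>"
    using assms(3) has_regular_G_diagonal_ordIso by blast
qed

end

theory Submission
  imports Defs
begin

text \<open>For every index \<open>\<eta>\<close> cover \<open>X\<close> by open sets \<open>V\<close> with \<open>V \<times> V \<subseteq> U \<eta>\<close> and choose a
  subfamily \<open>\<V> \<eta>\<close> of cardinality at most \<open>wL(X)\<close> with dense union. A point \<open>x\<close> with local base
  \<open>b x \<alpha>\<close> is coded by a choice of members of \<open>\<V> \<eta>\<close> that meet \<open>b x \<alpha> \<inter> b x \<beta>\<close>, one for each
  triple \<open>((\<alpha>, \<beta>), \<eta>)\<close>. If \<open>x \<noteq> y\<close> had the same code, pick \<open>\<eta>\<close>, \<open>\<alpha>\<close>, \<open>\<beta>\<close> such that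
  \<open>b x \<alpha> \<times> b y \<beta>\<close> misses \<open>U \<eta>\<close>: the common choice \<open>V\<close> for \<open>((\<alpha>, \<beta>), \<eta>)\<close> meets both
  \<open>b x \<alpha>\<close> and \<open>b y \<beta>\<close>, so \<open>V \<times> V\<close> meets \<open>b x \<alpha> \<times> b y \<beta>\<close> inside \<open>U \<eta>\<close>.\<close>

lemma card_order_indexing:
  assumes "|A| \<le>o \<kappa>" "Card_order \<kappa>" "A \<noteq> {}"
  obtains f where "f ` Field \<kappa> = A"
proof -
  have "|A| \<le>o |Field \<kappa>|"
    by (rule ordLeq_ordIso_trans[OF assms(1) ordIso_symmetric[OF card_of_Field_ordIso[OF assms(2)]]])
  then have "\<exists>f. f ` Field \<kappa> = A" by (simp add: card_of_ordLeq2[OF assms(3)])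
  then show thesis using that by (elim exE)
qed

text \<open>All points share the index set \<open>Field \<kappa>\<close>, so the codes of different
  points can be compared index by index.\<close>

lemma local_base_indexing:
  assumes "has_local_bases_upto X \<kappa>" "Card_order \<kappa>"
  obtains b where "\<And>x. x \<in> topspace X \<Longrightarrow> local_base_at X x (b x ` Field \<kappa>)"
proof -
  have "\<exists>f. local_base_at X x (f ` Field \<kappa>)" if x: "x \<in> topspace X" for x
  proof -
    obtain \<B> where B: "local_base_at X x \<B>" "|\<B>| \<le>o \<kappa>"
      using assms(1) x unfolding has_local_bases_upto_def by blast
    from B(1) x have "\<B> \<noteq> {}" by (auto simp: local_base_at_def)
    then obtain f where "f ` Field \<kappa> = \<B>"
      by (rule card_order_indexing[OF B(2) assms(2)])
    with B(1) show ?thesis by blast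
  qed
  then show thesis using that by metis
qed

text \<open>A box \<open>A \<times> B\<close> around \<open>(x, x)\<close> inside \<open>W\<close>
  yields the neighbourhood \<open>A \<inter> B\<close> of \<open>x\<close>, whose square lies in
  \<open>W\<close>. Such sets cover \<open>X\<close>, so the weak Lindelof property applies to
  them.\<close>

lemma weakly_Lindelof_small_squares:
  assumes "weakly_Lindelof_upto X \<mu>" "openin (prod_topology X X) W" "diagonal X \<subseteq> W"
  shows "\<exists>\<V>. |\<V>| \<le>o \<mu> \<and> X closure_of \<Union>\<V> = topspace X \<and>
    (\<forall>V \<in> \<V>. openin X V \<and> V \<times> V \<subseteq> W)"
proof -
  let ?C = "{V. openin X V \<and> V \<times> V \<subseteq> W}"
  have "topspace X \<subseteq> \<Union>?C"
  proof
    fix x assume "x \<in> topspace X"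
    then have "(x, x) \<in> W" using assms(3) by (auto simp: diagonal_def)
    then obtain A B where "openin X A" "openin X B" "x \<in> A" "x \<in> B" "A \<times> B \<subseteq> W"
      using assms(2) unfolding openin_prod_topology_alt by meson
    then have "A \<inter> B \<in> ?C" "x \<in> A \<inter> B" by auto
    then show "x \<in> \<Union>?C" by blast
  qed
  then have "(\<forall>V \<in> ?C. openin X V) \<and> \<Union>?C = topspace X"
    using openin_subset by blast
  then obtain \<V> where "\<V> \<subseteq> ?C" "|\<V>| \<le>o \<mu>" "X closure_of \<Union>\<V> = topspace X"
    using assms(1) unfolding weakly_Lindelof_upto_def by meson
  then show ?thesis by (intro exI[of _ \<V>]) auto
qed

text \<open>The exponent is the cardinality of the set of triples that index a code; the two factors
  \<open>\<kappa>\<close> come from the two base indices.\<close>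

lemma card_topspace_le_cexp:
  assumes wL: "weakly_Lindelof_upto X \<mu>" and l: "Card_order \<mu>"
    and \<kappa>: "has_local_bases_upto X \<kappa>" and c: "Card_order \<kappa>"
    and \<delta>: "has_regular_G_diagonal X \<delta>"
  shows "|topspace X| \<le>o \<mu> ^c ((\<kappa> *c \<kappa>) *c \<delta>)"
proof -
  let ?Y = "prod_topology X X"
  obtain b where b: "\<And>x. x \<in> topspace X \<Longrightarrow> local_base_at X x (b x ` Field \<kappa>)"
    using local_base_indexing[OF \<kappa> c] by blast
  have b_open: "openin X (b x \<alpha>)" "x \<in> b x \<alpha>" if "x \<in> topspace X" "\<alpha> \<in> Field \<kappa>" for x \<alpha>
    using b that unfolding local_base_at_def by blast+
  have b_small: "\<exists>\<alpha> \<in> Field \<kappa>. b x \<alpha> \<subseteq> A" if "openin X A" "x \<in> A" for x A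
    using b[of x] that openin_subset unfolding local_base_at_def by blast
  obtain U where U: "\<forall>\<eta> \<in> Field \<delta>. openin ?Y (U \<eta>)"
    "diagonal X = \<Inter> (U ` Field \<delta>)"
    "diagonal X = (\<Inter>\<eta> \<in> Field \<delta>. ?Y closure_of U \<eta>)"
    using \<delta> unfolding has_regular_G_diagonal_def by (elim exE conjE) (rule that)
  have "\<exists>\<V>. |\<V>| \<le>o \<mu> \<and> X closure_of \<Union>\<V> = topspace X \<and>
          (\<forall>V \<in> \<V>. openin X V \<and> V \<times> V \<subseteq> U \<eta>)" if "\<eta> \<in> Field \<delta>" for \<eta>
  proof -
    have "diagonal X \<subseteq> U \<eta>" using U(2) that by blast
    then show ?thesis by (rule weakly_Lindelof_small_squares[OF wL bspec[OF U(1) that]])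
  qed
  then obtain \<V> where V: "\<And>\<eta>. \<eta> \<in> Field \<delta> \<Longrightarrow> |\<V> \<eta>| \<le>o \<mu>"
    "\<And>\<eta>. \<eta> \<in> Field \<delta> \<Longrightarrow> X closure_of \<Union>(\<V> \<eta>) = topspace X"
    "\<And>\<eta> V. \<eta> \<in> Field \<delta> \<Longrightarrow> V \<in> \<V> \<eta> \<Longrightarrow> V \<times> V \<subseteq> U \<eta>"
    by metis
  \<comment> \<open>The families \<open>\<V> \<eta>\<close> vary with \<open>\<eta>\<close>;
    embedding each into \<open>Field \<mu>\<close> gives all codes one common set of values.\<close>
  have "\<exists>g. inj_on g (\<V> \<eta>) \<and> g ` \<V> \<eta> \<subseteq> Field \<mu>" if "\<eta> \<in> Field \<delta>" for \<eta>
  proof -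
    have "|\<V> \<eta>| \<le>o |Field \<mu>|"
      by (rule ordLeq_ordIso_trans[OF V(1)[OF that] ordIso_symmetric[OF card_of_Field_ordIso[OF l]]])
    then show ?thesis by (simp add: card_of_ordLeq)
  qed
  then obtain g where g: "\<And>\<eta>. \<eta> \<in> Field \<delta> \<Longrightarrow> inj_on (g \<eta>) (\<V> \<eta>)"
    "\<And>\<eta>. \<eta> \<in> Field \<delta> \<Longrightarrow> g \<eta> ` \<V> \<eta> \<subseteq> Field \<mu>"
    by metis
  \<comment> \<open>Meeting the intersection lets one choice serve \<open>x\<close> in either role:
    as first point of a pair through \<open>b x \<alpha>\<close>, as second through
    \<open>b x \<beta>\<close>.\<close>
  have "\<exists>V. V \<in> \<V> \<eta> \<and> V \<inter> (b x \<alpha> \<inter> b x \<beta>) \<noteq> {}"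
    if "x \<in> topspace X" "\<alpha> \<in> Field \<kappa>" "\<beta> \<in> Field \<kappa>" "\<eta> \<in> Field \<delta>" for x \<alpha> \<beta> \<eta>
  proof -
    have "x \<in> X closure_of \<Union>(\<V> \<eta>)" using V(2) that by simp
    moreover have "openin X (b x \<alpha> \<inter> b x \<beta>)" "x \<in> b x \<alpha> \<inter> b x \<beta>"
      using b_open that by auto
    ultimately show ?thesis unfolding in_closure_of by blast
  qed
  then obtain v where v: "\<And>x \<alpha> \<beta> \<eta>. \<lbrakk>x \<in> topspace X; \<alpha> \<in> Field \<kappa>; \<beta> \<in> Field \<kappa>; \<eta> \<in> Field \<delta>\<rbrakk> \<Longrightarrow>
      v x \<alpha> \<beta> \<eta> \<in> \<V> \<eta> \<and> v x \<alpha> \<beta> \<eta> \<inter> (b x \<alpha> \<inter> b x \<beta>) \<noteq> {}"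
    by metis
  let ?I = "(Field \<kappa> \<times> Field \<kappa>) \<times> Field \<delta>"
  \<comment> \<open>The value \<open>undefined\<close> outside \<open>?I\<close> is what membership
    in \<open>Func\<close> demands.\<close>
  define F where "F x i = (if i \<in> ?I then case i of ((\<alpha>, \<beta>), \<eta>) \<Rightarrow> g \<eta> (v x \<alpha> \<beta> \<eta>) else undefined)"
    for x i
  have "inj_on F (topspace X)"
  proof (rule inj_onI, rule ccontr)
    fix x y assume x: "x \<in> topspace X" and y: "y \<in> topspace X" and "F x = F y" "x \<noteq> y"
    then have "(x, y) \<notin> diagonal X" by (simp add: diagonal_def)
    \<comment> \<open>Here the closures in the regular diagonal matter: \<open>(x, y)\<close> has a
      whole neighbourhood \<open>T\<close> disjoint from \<open>U \<eta>\<close>.\<close>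
    then obtain \<eta> where \<eta>: "\<eta> \<in> Field \<delta>" "(x, y) \<notin> ?Y closure_of U \<eta>" using U(3) by blast
    then obtain T where T: "openin ?Y T" "(x, y) \<in> T" "\<And>p q. (p, q) \<in> U \<eta> \<Longrightarrow> (p, q) \<notin> T"
      using x y unfolding in_closure_of by auto
    obtain A B where AB: "openin X A" "openin X B" "x \<in> A" "y \<in> B" "A \<times> B \<subseteq> T"
      using T(1,2) unfolding openin_prod_topology_alt by meson
    obtain \<alpha> \<beta> where ab: "\<alpha> \<in> Field \<kappa>" "b x \<alpha> \<subseteq> A" "\<beta> \<in> Field \<kappa>" "b y \<beta> \<subseteq> B"
      using b_small AB by meson
    have "F x ((\<alpha>, \<beta>), \<eta>) = F y ((\<alpha>, \<beta>), \<eta>)" using \<open>F x = F y\<close> by simp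
    then have "g \<eta> (v x \<alpha> \<beta> \<eta>) = g \<eta> (v y \<alpha> \<beta> \<eta>)" using ab \<eta> by (simp add: F_def)
    moreover have "v x \<alpha> \<beta> \<eta> \<in> \<V> \<eta>" "v y \<alpha> \<beta> \<eta> \<in> \<V> \<eta>" using v x y ab \<eta> by auto
    ultimately have "v x \<alpha> \<beta> \<eta> = v y \<alpha> \<beta> \<eta>" using inj_onD[OF g(1)[OF \<eta>(1)]] by blast
    moreover obtain p where "p \<in> v x \<alpha> \<beta> \<eta>" "p \<in> b x \<alpha>" using v x ab \<eta> by blast
    moreover obtain q where "q \<in> v y \<alpha> \<beta> \<eta>" "q \<in> b y \<beta>" using v y ab \<eta> by blast
    ultimately have "(p, q) \<in> U \<eta>" "(p, q) \<in> T"
      using V(3)[OF \<eta>(1) \<open>v y \<alpha> \<beta> \<eta> \<in> \<V> \<eta>\<close>] ab AB by auto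
    then show False using T by blast
  qed
  moreover have "F ` topspace X \<subseteq> Func ?I (Field \<mu>)"
  proof (intro image_subsetI)
    fix x assume "x \<in> topspace X"
    have "g \<eta> (v x \<alpha> \<beta> \<eta>) \<in> Field \<mu>"
      if i: "\<alpha> \<in> Field \<kappa>" "\<beta> \<in> Field \<kappa>" "\<eta> \<in> Field \<delta>" for \<alpha> \<beta> \<eta>
      by (rule subsetD[OF g(2)[OF i(3)] imageI[OF conjunct1[OF v[OF \<open>x \<in> topspace X\<close> i]]]])
    then show "F x \<in> Func ?I (Field \<mu>)" by (auto simp: Func_def F_def)
  qed
  ultimately have "|topspace X| \<le>o |Func ?I (Field \<mu>)|"
    using card_of_ordLeq by blast
  then show ?thesis by (simp add: cexp_def cprod_def Field_card_of)
qed

theorem theorem4p6: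
  fixes X :: "'a topology"
  assumes "urysohn_space X"
  shows "|topspace X| \<le>o weak_Lindelof_number X ^c (character X *c regular_diagonal_degree X)"
proof -
  let ?\<mu> = "weak_Lindelof_number X" and ?\<kappa> = "character X" and ?\<delta> = "regular_diagonal_degree X"
  have \<mu>: "Cinfinite ?\<mu>" "weakly_Lindelof_upto X ?\<mu>"
    and \<kappa>: "Cinfinite ?\<kappa>" "has_local_bases_upto X ?\<kappa>"
    and \<delta>: "has_regular_G_diagonal X ?\<delta>"
    using is_least_weak_Lindelof_number[of X] is_least_character[of X]
      is_least_regular_diagonal_degree[OF assms]
    unfolding is_least_infinite_cardinal_def by blast+
  \<comment> \<open>Since the character is infinite, the pair of base indices costs no more than a
    single one.\<close>
  have "?\<kappa> *c ?\<kappa> \<le>o ?\<kappa>" using \<kappa>(1) cprod_infinite ordIso_imp_ordLeq by blast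
  then have "(?\<kappa> *c ?\<kappa>) *c ?\<delta> \<le>o ?\<kappa> *c ?\<delta>" by (rule cprod_mono1)
  then have "?\<mu> ^c ((?\<kappa> *c ?\<kappa>) *c ?\<delta>) \<le>o ?\<mu> ^c (?\<kappa> *c ?\<delta>)"
    using \<mu>(1) by (intro cexp_mono2') (auto simp: cprod_def Field_card_of)
  moreover have "|topspace X| \<le>o ?\<mu> ^c ((?\<kappa> *c ?\<kappa>) *c ?\<delta>)"
    using \<mu> \<kappa> \<delta> by (intro card_topspace_le_cexp) auto
  ultimately show ?thesis using ordLeq_transitive by blast
qed

end
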